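(* Let $q$ be a prime power, $V$ an $n$-dimensional vector space over $\mathbb{F}_q$, $P$ a finite poset, $\mathcal{F}$ a $P$-free family of subspaces of $V$, and $\mathcal{H}$ a simple family of subspaces of $V$. Then \[ \sum_{F\in\mathcal{F}}\frac{N_{\dim(F)}(\mathcal{H})}{\begin{bmatrix} n\\ \dim(F)\end{bmatrix}_q}\le \alpha(\mathcal{H},P). \] In particular, if $N_k(\mathcal{H})=N$ for a given positive integer $N$ and all $k$, then \[ \sum_{F\in\mathcal{F}}\frac{1}{\begin{bmatrix} n\\ \dim(F)\end{bmatrix}_q}\le\frac{\alpha(\mathcal{H},P)}{N}. \]
   Context: Subspaces are ordered by inclusion; a family is $P$-free if it contains no subposet isomorphic to $P$, where $P$ is a subposet of $Q$ if there is an injection $\phi:P\to Q$ with $x\le_P y\Rightarrow \phi(x)\le_Q\phi(y)$. A family $\mathcal{H}$ of subspaces of $V$ is simple if there is a basis $\{v_1,\dots,v_n\}$ of $V$ such that every member of $\mathcal{H}$ is of the form $\mathrm{span}(S)$ for some $S\subseteq\{v_1,\dots,v_n\}$. $\alpha(\mathcal{H},P)$ denotes the maximum size of a $P$-free subfamily of $\mathcal{H}$, and $N_i(\mathcal{H})$ denotes the number of $i$-dimensional subspaces in $\mathcal{H}$. $\begin{bmatrix} n\\ k\end{bmatrix}_q=\prod_{0\le i<k}\frac{q^{n-i}-1}{q^{k-i}-1}$. *)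

theory Defs
  imports Complex_Main "HOL-Library.Cardinality"
begin

text \<open>
  The poset \<open>P\<close> is a carrier \<open>A\<close> with an order relation \<open>r\<close> on it. Containment is weak
  (not necessarily induced): the injection preserves, but need not reflect, the order.
\<close>

definition contains_poset :: "'p set \<Rightarrow> 'p rel \<Rightarrow> 'b set set \<Rightarrow> bool" where
  "contains_poset A r \<G> \<longleftrightarrow>
     (\<exists>\<phi>. inj_on \<phi> A \<and> \<phi> ` A \<subseteq> \<G> \<and> (\<forall>(x, y)\<in>r. \<phi> x \<subseteq> \<phi> y))"

definition poset_free :: "'p set \<Rightarrow> 'p rel \<Rightarrow> 'b set set \<Rightarrow> bool" where
  "poset_free A r \<G> \<longleftrightarrow> \<not> contains_poset A r \<G>"

text \<open>
  The maximum is over a finite set when \<open>\<H>\<close> is finite. That set is empty only if \<open>A\<close> is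
  empty, and then no family whatsoever is \<open>P\<close>-free.
\<close>

definition max_poset_free :: "'b set set \<Rightarrow> 'p set \<Rightarrow> 'p rel \<Rightarrow> nat" where
  "max_poset_free \<H> A r = Max {card \<G> | \<G>. \<G> \<subseteq> \<H> \<and> poset_free A r \<G>}"

definition q_binomial :: "nat \<Rightarrow> nat \<Rightarrow> nat \<Rightarrow> real" where
  "q_binomial q n k = (\<Prod>i<k. (real q ^ (n - i) - 1) / (real q ^ (k - i) - 1))"

context vector_space
begin

definition simple_family :: "'b set set \<Rightarrow> bool" where
  "simple_family \<H> \<longleftrightarrow>
     (\<exists>B. independent B \<and> span B = UNIV \<and> (\<forall>U\<in>\<H>. \<exists>S\<subseteq>B. U = span S))"

definition num_dim :: "nat \<Rightarrow> 'b set set \<Rightarrow> nat" where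
  "num_dim i \<H> = card {U \<in> \<H>. dim U = i}"

end

end

theory Submission
  imports Defs
begin

text \<open>
  For a linear automorphism \<open>f\<close> of \<open>V\<close>, the members of \<open>\<H>\<close> mapped into \<open>\<F>\<close> by \<open>f\<close> form a
  \<open>P\<close>-free subfamily of \<open>\<H>\<close>, so there are at most \<open>\<alpha>(\<H>,P)\<close> of them. Average over the
  general linear group: as it acts transitively on the \<open>k\<close>-dimensional subspaces, a fixed
  \<open>k\<close>-dimensional \<open>H\<close> is mapped to a fixed \<open>k\<close>-dimensional \<open>F\<close> by exactly one in
  \<open>q_binomial q n k\<close> of all automorphisms.
\<close>

section \<open>P-free families and Gaussian binomial coefficients\<close>

lemma poset_free_preimage:
  assumes "poset_free A r \<F>" and "inj f"
  shows "poset_free A r {U \<in> \<H>. f ` U \<in> \<F>}"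
  unfolding poset_free_def
proof
  assume "contains_poset A r {U \<in> \<H>. f ` U \<in> \<F>}"
  then obtain \<phi> where \<phi>: "inj_on \<phi> A" "\<phi> ` A \<subseteq> {U \<in> \<H>. f ` U \<in> \<F>}" "\<forall>(x, y)\<in>r. \<phi> x \<subseteq> \<phi> y"
    unfolding contains_poset_def by blast
  \<comment> \<open>A copy of the poset in the preimage family is pushed forward along
    \<open>f\<close>: taking images is monotone, and it is injective on sets because
    \<open>f\<close> is injective.\<close>
  have "inj_on (\<lambda>x. f ` \<phi> x) A"
    using \<phi>(1) assms(2) by (auto simp: inj_on_def inj_image_eq_iff)
  moreover have "(\<lambda>x. f ` \<phi> x) ` A \<subseteq> \<F>"
    using \<phi>(2) by blast
  moreover have "\<forall>(x, y)\<in>r. f ` \<phi> x \<subseteq> f ` \<phi> y"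
    using \<phi>(3) by blast
  ultimately have "contains_poset A r \<F>"
    unfolding contains_poset_def by blast
  with assms(1) show False
    by (simp add: poset_free_def)
qed

lemma card_le_max_poset_free:
  assumes "finite \<H>" and "\<G> \<subseteq> \<H>" and "poset_free A r \<G>"
  shows "card \<G> \<le> max_poset_free \<H> A r"
proof -
  have "{card \<G> | \<G>. \<G> \<subseteq> \<H> \<and> poset_free A r \<G>} \<subseteq> card ` Pow \<H>"
    by blast
  then have "finite {card \<G> | \<G>. \<G> \<subseteq> \<H> \<and> poset_free A r \<G>}"
    by (rule finite_subset) (simp add: assms(1))
  then show ?thesis
    unfolding max_poset_free_def using assms(2,3) by (intro Max_ge) auto
qed

text \<open>For \<open>q\<close> the order of a field, the two products count the ordered bases of a
  \<open>k\<close>-dimensional space and the independent \<open>k\<close>-lists of an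
  \<open>n\<close>-dimensional one. The identity holds factor by factor once \<open>q ^ i\<close> is
  taken out; this division-free form is the one that double counting produces.\<close>

lemma q_binomial_times_prod:
  assumes "2 \<le> q" and "k \<le> n"
  shows "q_binomial q n k * (\<Prod>i<k. real q ^ k - real q ^ i) = (\<Prod>i<k. real q ^ n - real q ^ i)"
  unfolding q_binomial_def prod.distrib[symmetric]
proof (rule prod.cong[OF refl])
  fix i assume "i \<in> {..<k}"
  then have i: "i < k" by simp
  have "real q ^ (k - i) > 1"
    using assms(1) i by (intro one_less_power) auto
  moreover have "real q ^ k = real q ^ i * real q ^ (k - i)" "real q ^ n = real q ^ i * real q ^ (n - i)"
    using i assms(2) by (simp_all flip: power_add)
  ultimately show "(real q ^ (n - i) - 1) / (real q ^ (k - i) - 1) * (real q ^ k - real q ^ i)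
      = real q ^ n - real q ^ i"
    by (simp add: field_simps)
qed

section \<open>Counting vectors, independent lists and subspaces over a finite field\<close>

locale finite_vector_space = finite_dimensional_vector_space scale Basis
  for scale :: "'a::{field,finite} \<Rightarrow> 'b::ab_group_add \<Rightarrow> 'b" and Basis :: "'b set"
begin

text \<open>By induction on \<open>S\<close>: after adding a vector \<open>a\<close>, every element
  of the span is \<open>scale c a + x\<close> for exactly one scalar \<open>c\<close> and one
  \<open>x\<close> in the old span, so the size grows by the factor \<open>CARD('a)\<close>.\<close>

lemma finite_card_span:
  assumes "independent S"
  shows "finite (span S) \<and> card (span S) = CARD('a) ^ card S"
proof -
  have "finite S"
    using assms by (rule finiteI_independent)
  then show ?thesis
    using assms
  proof (induction S)
    case empty
    then show ?case by simp
  next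
    case (insert a S)
    have S: "independent S" "a \<notin> span S"
      using insert.prems insert.hyps(2) by (auto simp: independent_insert)
    let ?f = "\<lambda>(c, x). scale c a + x"
    have "inj_on ?f (UNIV \<times> span S)"
    proof (rule inj_onI, clarify)
      fix c x d y
      assume x: "x \<in> span S" and y: "y \<in> span S" and eq: "scale c a + x = scale d a + y"
      then have "scale (c - d) a = y - x"
        by (simp add: scale_left_diff_distrib algebra_simps)
      then have "scale (c - d) a \<in> span S"
        using x y by (simp add: span_diff)
      \<comment> \<open>If \<open>c\<close> and \<open>d\<close> differed, dividing by
        \<open>c - d\<close> would put \<open>a\<close> in \<open>span S\<close>.\<close>
      then have "scale (inverse (c - d)) (scale (c - d) a) \<in> span S"
        by (rule span_scale)
      then have "c = d"
        using S(2) by (cases "c = d") auto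
      with eq show "c = d \<and> x = y" by simp
    qed
    moreover have "?f ` (UNIV \<times> span S) = span (insert a S)"
    proof (intro equalityI subsetI)
      fix v assume "v \<in> ?f ` (UNIV \<times> span S)"
      then obtain c x where "v = scale c a + x" "x \<in> span S"
        by auto
      then have "v - scale c a \<in> span S"
        by simp
      then show "v \<in> span (insert a S)"
        by (auto simp: span_breakdown_eq)
    next
      fix v assume "v \<in> span (insert a S)"
      then obtain c where "v - scale c a \<in> span S"
        by (auto simp: span_breakdown_eq)
      then show "v \<in> ?f ` (UNIV \<times> span S)"
        by (intro image_eqI[where x="(c, v - scale c a)"]) auto
    qed
    ultimately have "bij_betw ?f (UNIV \<times> span S) (span (insert a S))"
      by (simp add: bij_betw_def)
    then show ?case
      using insert.IH[OF S(1)] insert.hyps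
      by (auto simp: card_cartesian_product dest: bij_betw_same_card bij_betw_finite)
  qed
qed

lemma finite_vectors: "finite (UNIV :: 'b set)"
  using finite_card_span[OF independent_Basis] by (simp add: span_Basis)

lemma card_subspace:
  assumes "subspace W"
  shows "card W = CARD('a) ^ dim W"
proof -
  obtain S where "S \<subseteq> W" "independent S" "W \<subseteq> span S" "card S = dim W"
    using basis_exists by blast
  then show ?thesis
    using finite_card_span[of S] assms by (metis span_minimal subset_antisym)
qed

text \<open>Lists rather than sets, since ordered choices are counted by a plain product.
  Distinctness is demanded separately because \<open>set xs\<close> does not see
  repetitions.\<close>

definition independent_lists :: "'b set \<Rightarrow> nat \<Rightarrow> 'b list set" where
  "independent_lists W k = {xs. length xs = k \<and> distinct xs \<and> independent (set xs) \<and> set xs \<subseteq> W}"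

lemma finite_independent_lists: "finite (independent_lists W k)"
proof (rule finite_subset)
  show "independent_lists W k \<subseteq> {xs. set xs \<subseteq> UNIV \<and> length xs = k}"
    by (auto simp: independent_lists_def)
qed (rule finite_lists_length_eq[OF finite_vectors])

text \<open>The list is built one vector at a time: the next vector must avoid the span of the
  previous \<open>k\<close>, which has \<open>CARD('a) ^ k\<close> elements. If \<open>k\<close>
  exceeds \<open>dim W\<close>, the factor for \<open>i = dim W\<close> is 0, matching the absence
  of such lists.\<close>

lemma card_independent_lists:
  assumes W: "subspace W"
  shows "card (independent_lists W k) = (\<Prod>i<k. CARD('a) ^ dim W - CARD('a) ^ i)"
proof (induction k)
  case 0
  have "independent_lists W 0 = {[]}"
    by (auto simp: independent_lists_def independent_empty)
  then show ?case by simp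
next
  case (Suc k)
  let ?L = "independent_lists W k"
  have "independent_lists W (Suc k) = (\<lambda>(xs, x). x # xs) ` (SIGMA xs:?L. W - span (set xs))"
  proof (intro equalityI subsetI)
    fix ys assume "ys \<in> independent_lists W (Suc k)"
    then obtain x xs where "ys = x # xs" "xs \<in> ?L" "x \<in> W" "x \<notin> span (set xs)"
      by (cases ys) (auto simp: independent_lists_def independent_insert)
    then show "ys \<in> (\<lambda>(xs, x). x # xs) ` (SIGMA xs:?L. W - span (set xs))"
      by force
  next
    fix ys assume "ys \<in> (\<lambda>(xs, x). x # xs) ` (SIGMA xs:?L. W - span (set xs))"
    then show "ys \<in> independent_lists W (Suc k)"
      by (auto simp: independent_lists_def independent_insertI span_base)
  qed
  then have "card (independent_lists W (Suc k)) = card (SIGMA xs:?L. W - span (set xs))"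
    by (simp add: card_image inj_on_def)
  also have "\<dots> = (\<Sum>xs\<in>?L. card (W - span (set xs)))"
    by (intro card_SigmaI) (auto intro: finite_independent_lists finite_subset[OF subset_UNIV finite_vectors])
  also have "\<dots> = (\<Sum>xs\<in>?L. CARD('a) ^ dim W - CARD('a) ^ k)"
  proof (rule sum.cong[OF refl])
    fix xs assume xs: "xs \<in> ?L"
    have "span (set xs) \<subseteq> W"
      using xs W by (intro span_minimal) (auto simp: independent_lists_def)
    moreover have "card (span (set xs)) = CARD('a) ^ k"
      using xs finite_card_span[of "set xs"] by (auto simp: independent_lists_def distinct_card)
    ultimately show "card (W - span (set xs)) = CARD('a) ^ dim W - CARD('a) ^ k"
      using card_subspace[OF W] by (simp add: card_Diff_subset finite_subset[OF subset_UNIV finite_vectors])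
  qed
  finally show ?case
    using Suc.IH by simp
qed

lemma two_le_card_scalars: "2 \<le> CARD('a)"
proof -
  have "card {0, 1 :: 'a} \<le> CARD('a)"
    by (intro card_mono) auto
  then show ?thesis by simp
qed

text \<open>Double counting: every independent \<open>k\<close>-list lies in exactly one
  \<open>k\<close>-dimensional subspace, its span, and all these subspaces contain equally many such
  lists.\<close>

lemma card_subspaces_of_dim:
  assumes k: "k \<le> dim (UNIV :: 'b set)"
  shows "real (card {W. subspace W \<and> dim W = k}) = q_binomial CARD('a) (dim (UNIV :: 'b set)) k"
proof -
  let ?q = "CARD('a)" and ?n = "dim (UNIV :: 'b set)" and ?Sub = "{W. subspace W \<and> dim W = k}"
  have "finite ?Sub"
    using finite_vectors by (metis finite_Collect_subsets finite_subset subset_UNIV Collect_mono)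
  have "independent_lists UNIV k = (\<Union>W\<in>?Sub. independent_lists W k)"
  proof (intro equalityI subsetI)
    fix xs assume xs: "xs \<in> independent_lists UNIV k"
    then have "span (set xs) \<in> ?Sub"
      by (auto simp: independent_lists_def dim_eq_card_independent distinct_card)
    moreover have "xs \<in> independent_lists (span (set xs)) k"
      using xs by (auto simp: independent_lists_def span_base)
    ultimately show "xs \<in> (\<Union>W\<in>?Sub. independent_lists W k)"
      by blast
  qed (auto simp: independent_lists_def)
  moreover have span_eq: "span (set xs) = W" if "W \<in> ?Sub" "xs \<in> independent_lists W k" for W xs
    using that card_eq_dim[of "set xs" W] span_minimal[of "set xs" W]
    by (auto simp: independent_lists_def distinct_card)
  then have "card (\<Union>W\<in>?Sub. independent_lists W k) = (\<Sum>W\<in>?Sub. card (independent_lists W k))"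
    using \<open>finite ?Sub\<close>
    by (intro card_UN_disjoint ballI impI) (blast intro: finite_independent_lists)+
  ultimately have "card (independent_lists UNIV k) = card ?Sub * (\<Prod>i<k. ?q ^ k - ?q ^ i)"
    by (simp add: card_independent_lists)
  then have "(\<Prod>i<k. ?q ^ ?n - ?q ^ i) = card ?Sub * (\<Prod>i<k. ?q ^ k - ?q ^ i)"
    by (simp only: card_independent_lists[OF subspace_UNIV])
  then have "real (\<Prod>i<k. ?q ^ ?n - ?q ^ i) = real (card ?Sub * (\<Prod>i<k. ?q ^ k - ?q ^ i))"
    by (rule arg_cong)
  \<comment> \<open>Truncated subtraction agrees with real subtraction here because
    \<open>i < k \<le> m\<close>; the cases \<open>m = ?n\<close> and \<open>m = k\<close> are
    used.\<close>
  moreover have "real (\<Prod>i<k. ?q ^ m - ?q ^ i) = (\<Prod>i<k. real ?q ^ m - real ?q ^ i)" if "k \<le> m" for m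
    unfolding of_nat_prod
  proof (rule prod.cong[OF refl])
    fix i assume "i \<in> {..<k}"
    then have "?q ^ i \<le> ?q ^ m"
      using that two_le_card_scalars by (intro power_increasing) auto
    then show "real (?q ^ m - ?q ^ i) = real ?q ^ m - real ?q ^ i"
      by (simp add: of_nat_diff)
  qed
  ultimately have "(\<Prod>i<k. real ?q ^ ?n - real ?q ^ i)
      = real (card ?Sub) * (\<Prod>i<k. real ?q ^ k - real ?q ^ i)"
    using k by (simp only: of_nat_mult order_refl)
  then have "real (card ?Sub) * (\<Prod>i<k. real ?q ^ k - real ?q ^ i)
      = q_binomial ?q ?n k * (\<Prod>i<k. real ?q ^ k - real ?q ^ i)"
    using q_binomial_times_prod[OF two_le_card_scalars k] by (simp only:)
  moreover have "(\<Prod>i<k. real ?q ^ k - real ?q ^ i) \<noteq> 0"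
    using two_le_card_scalars by auto
  ultimately show ?thesis
    by (rule mult_right_cancel[THEN iffD1, rotated])
qed

section \<open>The general linear group and its action on subspaces\<close>

definition automorphisms :: "('b \<Rightarrow> 'b) set" where
  "automorphisms = {f. Vector_Spaces.linear scale scale f \<and> bij f}"

lemma finite_automorphisms: "finite automorphisms"
  using finite_set_of_finite_funs[OF finite_vectors finite_vectors] by (rule rev_finite_subset) simp

lemma id_in_automorphisms: "id \<in> automorphisms"
  by (simp add: automorphisms_def linear_id)

lemma comp_in_automorphisms:
  assumes "f \<in> automorphisms" and "g \<in> automorphisms"
  shows "g \<circ> f \<in> automorphisms"
  using assms unfolding automorphisms_def
  by (blast intro: bij_comp Vector_Spaces.linear_compose)

lemma
  assumes "f \<in> automorphisms" and "subspace W"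
  shows subspace_automorphism: "subspace (f ` W)"
    and dim_automorphism: "dim (f ` W) = dim W"
proof -
  interpret finite_dimensional_vector_space_pair_1 scale Basis scale
    by unfold_locales
  have f: "Vector_Spaces.linear scale scale f" "inj f"
    using assms(1) by (auto simp: automorphisms_def bij_is_inj)
  show "subspace (f ` W)"
    using f(1) assms(2) by (rule linear_subspace_image)
  show "dim (f ` W) = dim W"
    using f by (intro dim_image_eq) (auto intro: inj_on_subset)
qed

text \<open>Bases of \<open>U\<close> and \<open>W\<close> have the same size, and so do their
  complements in bases of the whole space. A bijection between the two large bases that matches the
  small ones extends linearly to the required map.\<close>

lemma automorphism_transitive:
  assumes U: "subspace U" and W: "subspace W" and dims: "dim U = dim W"
  obtains f where "f \<in> automorphisms" and "f ` U = W"
proof -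
  interpret vector_space_pair scale scale
    by unfold_locales
  obtain B where B: "B \<subseteq> U" "independent B" "U \<subseteq> span B" "card B = dim U"
    using basis_exists by blast
  obtain C where C: "C \<subseteq> W" "independent C" "W \<subseteq> span C" "card C = dim W"
    using basis_exists by blast
  let ?B = "extend_basis B" and ?C = "extend_basis C"
  note eB = extend_basis_superset[OF B(2)] independent_extend_basis[OF B(2)] span_extend_basis[OF B(2)]
  note eC = extend_basis_superset[OF C(2)] independent_extend_basis[OF C(2)] span_extend_basis[OF C(2)]
  have fin: "finite X" for X :: "'b set"
    using finite_vectors by (rule finite_subset[OF subset_UNIV])
  have cards: "card ?B = card ?C"
    using eB eC by (metis dim_span_eq_card_independent)
  obtain g where g: "bij_betw g B C"
    using B(4) C(4) dims by (metis fin finite_same_card_bij)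
  have "card (?B - B) = card (?C - C)"
    using eB(1) eC(1) cards B(4) C(4) dims by (simp add: card_Diff_subset fin)
  then obtain h where h: "bij_betw h (?B - B) (?C - C)"
    by (metis fin finite_same_card_bij)
  define p where "p x = (if x \<in> B then g x else h x)" for x
  have pB: "p ` B = C" and "p ` (?B - B) = ?C - C"
    using g h by (auto simp: p_def bij_betw_def)
  then have pext: "p ` ?B = ?C"
    using eB(1) eC(1) by (metis Diff_partition image_Un)
  define f where "f = construct ?B p"
  have lin: "Vector_Spaces.linear scale scale f"
    unfolding f_def by (rule linear_construct[OF eB(2)])
  have "f ` ?B = p ` ?B" "f ` B = p ` B"
    using eB(1) by (auto simp: f_def construct_basis[OF eB(2)] intro!: image_cong)
  then have "range f = UNIV" "f ` span B = span C"
    using pB pext eB(3) eC(3) linear_span_image[OF lin, of ?B] linear_span_image[OF lin, of B] by auto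
  \<comment> \<open>A surjective linear endomorphism of a finite-dimensional space is
    injective.\<close>
  then have "f \<in> automorphisms"
    using linear_surj_imp_inj[OF lin] lin by (simp add: automorphisms_def bij_def)
  moreover have "span B = U" "span C = W"
    using B C U W by (simp_all add: span_minimal subset_antisym)
  ultimately show thesis
    using \<open>f ` span B = span C\<close> that by blast
qed

text \<open>The automorphisms are partitioned by the image of \<open>U\<close>, which can be any
  subspace of the same dimension. Composition with an automorphism taking \<open>X\<close> to
  \<open>Y\<close> injects the class of \<open>X\<close> into that of \<open>Y\<close>, so all
  classes have equal size.\<close>

lemma card_automorphisms_mapping:
  assumes U: "subspace U" and W: "subspace W" and dims: "dim U = dim W"
  shows "real (card {f \<in> automorphisms. f ` U = W})
    = real (card automorphisms) / q_binomial CARD('a) (dim (UNIV :: 'b set)) (dim W)"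
proof -
  let ?T = "\<lambda>X. {f \<in> automorphisms. f ` U = X}" and ?Sub = "{X. subspace X \<and> dim X = dim W}"
  have finT: "finite (?T X)" for X
    using finite_automorphisms by simp
  have le: "card (?T X) \<le> card (?T Y)" if X: "X \<in> ?Sub" and Y: "Y \<in> ?Sub" for X Y
  proof -
    obtain g where g: "g \<in> automorphisms" "g ` X = Y"
      using X Y automorphism_transitive[of X Y] by auto
    have "inj g"
      using g(1) by (simp add: automorphisms_def bij_is_inj)
    then have "inj_on ((\<circ>) g) (?T X)"
      by (auto simp: inj_on_def fun_eq_iff)
    moreover have "(\<circ>) g ` ?T X \<subseteq> ?T Y"
      using g by (auto simp: comp_in_automorphisms image_comp[symmetric])
    ultimately show ?thesis
      using finT by (rule card_inj_on_le)
  qed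
  have "finite ?Sub"
    using finite_vectors by (metis finite_Collect_subsets finite_subset subset_UNIV Collect_mono)
  have "automorphisms = (\<Union>X\<in>?Sub. ?T X)"
    using subspace_automorphism[OF _ U] dim_automorphism[OF _ U] dims by auto
  then have "card automorphisms = card (\<Union>X\<in>?Sub. ?T X)"
    by simp
  also have "\<dots> = (\<Sum>X\<in>?Sub. card (?T X))"
    using \<open>finite ?Sub\<close> finT by (intro card_UN_disjoint) auto
  \<comment> \<open>Applying \<open>le\<close> in both directions gives equality.\<close>
  also have "\<dots> = (\<Sum>X\<in>?Sub. card (?T W))"
    using W by (intro sum.cong refl antisym le) auto
  finally have "real (card automorphisms) = real (card ?Sub) * real (card (?T W))"
    by simp
  moreover have "card ?Sub \<noteq> 0"
    using \<open>finite ?Sub\<close> W by auto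
  moreover have "dim W \<le> dim (UNIV :: 'b set)"
    by (rule dim_subset) simp
  ultimately show ?thesis
    using card_subspaces_of_dim[of "dim W"] by (simp add: field_simps)
qed

section \<open>Averaging over the group\<close>

theorem sum_num_dim_le_max_poset_free:
  fixes \<F> \<H> :: "'b set set"
  assumes \<F>: "\<forall>U\<in>\<F>. subspace U" and free: "poset_free A r \<F>" and \<H>: "\<forall>U\<in>\<H>. subspace U"
  shows "(\<Sum>F\<in>\<F>. real (num_dim (dim F) \<H>) / q_binomial CARD('a) (dim (UNIV :: 'b set)) (dim F))
    \<le> real (max_poset_free \<H> A r)"
proof -
  let ?G = automorphisms and ?\<alpha> = "max_poset_free \<H> A r"
  let ?b = "\<lambda>F. q_binomial CARD('a) (dim (UNIV :: 'b set)) (dim F)"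
  have fin: "finite \<X>" for \<X> :: "'b set set"
    using finite_vectors by (simp add: Finite_Set.finite_set finite_subset[OF subset_UNIV])
  have count: "real (card {f \<in> ?G. f ` H = F}) = (if dim H = dim F then real (card ?G) / ?b F else 0)"
    if "F \<in> \<F>" "H \<in> \<H>" for F H
  proof (cases "dim H = dim F")
    case True
    then show ?thesis
      using card_automorphisms_mapping that \<F> \<H> by simp
  next
    case False
    then have "{f \<in> ?G. f ` H = F} = {}"
      using dim_automorphism that(2) \<H> by auto
    then show ?thesis
      using False by (simp only: card.empty of_nat_0 if_False)
  qed
  have "real (card ?G) * (\<Sum>F\<in>\<F>. real (num_dim (dim F) \<H>) / ?b F)
      = (\<Sum>F\<in>\<F>. \<Sum>H\<in>\<H>. if dim H = dim F then real (card ?G) / ?b F else 0)"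
    unfolding sum_distrib_left num_dim_def by (simp add: fin mult.commute[of "real (card ?G)"] flip: sum.inter_filter)
  also have "\<dots> = (\<Sum>F\<in>\<F>. \<Sum>H\<in>\<H>. real (card {f \<in> ?G. f ` H = F}))"
    by (intro sum.cong refl) (simp add: count)
  \<comment> \<open>Each count becomes a sum of indicators, so that the summation over
    \<open>f\<close> can be moved outermost.\<close>
  also have "\<dots> = (\<Sum>F\<in>\<F>. \<Sum>H\<in>\<H>. \<Sum>f\<in>?G. of_bool (f ` H = F))"
    by (simp add: finite_automorphisms Int_def)
  also have "\<dots> = (\<Sum>F\<in>\<F>. \<Sum>f\<in>?G. \<Sum>H\<in>\<H>. of_bool (f ` H = F))"
    by (intro sum.cong refl sum.swap)
  also have "\<dots> = (\<Sum>f\<in>?G. \<Sum>F\<in>\<F>. \<Sum>H\<in>\<H>. of_bool (f ` H = F))"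
    by (rule sum.swap)
  also have "\<dots> = (\<Sum>f\<in>?G. \<Sum>H\<in>\<H>. \<Sum>F\<in>\<F>. of_bool (f ` H = F))"
    by (intro sum.cong refl sum.swap)
  also have "\<dots> = (\<Sum>f\<in>?G. real (card {H \<in> \<H>. f ` H \<in> \<F>}))"
    by (simp add: fin of_bool_def sum.delta' flip: sum.inter_filter)
  also have "\<dots> \<le> (\<Sum>f\<in>?G. real ?\<alpha>)"
  proof (rule sum_mono)
    fix f assume "f \<in> ?G"
    then have "inj f"
      by (simp add: automorphisms_def bij_is_inj)
    then show "real (card {H \<in> \<H>. f ` H \<in> \<F>}) \<le> real ?\<alpha>"
      using fin poset_free_preimage[OF free] by (intro of_nat_mono card_le_max_poset_free) auto
  qed
  also have "\<dots> = real (card ?G) * real ?\<alpha>"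
    by simp
  finally have "real (card ?G) * (\<Sum>F\<in>\<F>. real (num_dim (dim F) \<H>) / ?b F) \<le> real (card ?G) * real ?\<alpha>" .
  moreover have "card ?G > 0"
    using finite_automorphisms id_in_automorphisms by (auto simp: card_gt_0_iff)
  ultimately show ?thesis
    by simp
qed

end

text \<open>The condition on \<open>N\<close> ranges over \<open>k \<le> n\<close>, the dimensions
  that subspaces can have: beyond \<open>n\<close> the count is 0, which a positive \<open>N\<close>
  would contradict.\<close>

theorem theorem14:
  fixes scale :: "'a::{field,finite} \<Rightarrow> 'b::ab_group_add \<Rightarrow> 'b"
    and Basis :: "'b set"
    and q n :: nat
    and A :: "'p set" and r :: "'p rel"
    and \<F> \<H> :: "'b set set"
  assumes "q = CARD('a)"
    and "finite_dimensional_vector_space scale Basis"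
    and "vector_space.dim scale (UNIV :: 'b set) = n"
    and "finite A" and "partial_order_on A r"
    and "\<forall>U\<in>\<F>. module.subspace scale U"
    and "poset_free A r \<F>"
    and "\<forall>U\<in>\<H>. module.subspace scale U"
    and "vector_space.simple_family scale \<H>"
  shows "(\<Sum>F\<in>\<F>. real (vector_space.num_dim scale (vector_space.dim scale F) \<H>)
              / q_binomial q n (vector_space.dim scale F))
           \<le> real (max_poset_free \<H> A r)
       \<and> (\<forall>N::nat. N > 0 \<longrightarrow> (\<forall>k\<le>n. vector_space.num_dim scale k \<H> = N) \<longrightarrow>
            (\<Sum>F\<in>\<F>. 1 / q_binomial q n (vector_space.dim scale F))
              \<le> real (max_poset_free \<H> A r) / real N)"
proof -
  interpret finite_dimensional_vector_space scale Basis
    by (rule assms(2))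
  interpret finite_vector_space scale Basis
    by unfold_locales
  have main: "(\<Sum>F\<in>\<F>. real (num_dim (dim F) \<H>) / q_binomial q n (dim F)) \<le> real (max_poset_free \<H> A r)"
    using sum_num_dim_le_max_poset_free[OF assms(6-8)] assms(1,3) by simp
  moreover have "(\<Sum>F\<in>\<F>. 1 / q_binomial q n (dim F)) \<le> real (max_poset_free \<H> A r) / real N"
    if N: "N > 0" "\<forall>k\<le>n. num_dim k \<H> = N" for N :: nat
  proof -
    \<comment> \<open>This bound lets the condition on \<open>N\<close> apply to every
      summand.\<close>
    have "dim F \<le> n" for F
      using dim_subset[OF subset_UNIV, of F] assms(3) by simp
    then have "real N * (\<Sum>F\<in>\<F>. 1 / q_binomial q n (dim F)) \<le> real (max_poset_free \<H> A r)"
      using main N(2) by (simp add: sum_distrib_left)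
    then show ?thesis
      using N(1) by (simp add: pos_le_divide_eq mult.commute)
  qed
  ultimately show ?thesis
    by blast
qed

end
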